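(* The following identities of power series in $q$ hold: $$G_8(q)|U_2=4\,G_8(q)+16\,G_8(q)^2,$$ $$\Phi_2(-q)|U_2=(1+4\,G_8(q))\,\Phi_2(-q^2),$$ $$(\Phi_2(-q)G_8(q))|U_2=(2\,G_8(q)+8\,G_8(q)^2)\,\Phi_2(-q^2),$$ $$(\Phi_2(-q)G_2(-q))|U_2=P(G_8(q))\,\Phi_2(-q^2),$$ where $P(x)$ is the polynomial $$P(x)=2\cdot 13x+2^3\cdot 403x^2+2^6\cdot 2015x^3+2^{10}\cdot 2431x^4+2^{15}\cdot 819x^5+2^{19}\cdot 325x^6+2^{22}\cdot 151x^7+2^{26}\cdot 19x^8+2^{30}x^9.$$
   Context: Define the power series $$\Phi_2(q)=\prod_{n\ge1}\frac{1-q^{2n}}{(1-q^n)^2},\quad G_2(q)=q\prod_{n\ge1}\left(\frac{1-q^{2n}}{1-q^n}\right)^{24},\quad G_8(q)=q\prod_{n\ge1}\frac{(1-q^{8n})^4(1-q^{2n})^2}{(1-q^{4n})^2(1-q^n)^4}.$$ Equivalently, with $q=e^{2\pi i\tau}$ and $\eta$ the Dedekind eta function, $\Phi_2(q)=\eta(2\tau)/\eta(\tau)^2$, $G_2(q)=(\eta(2\tau)/\eta(\tau))^{24}$, $G_8(q)=\frac{\eta^4(8\tau)\eta^2(2\tau)}{\eta^2(4\tau)\eta^4(\tau)}$. The Atkin operator $U_2$ acts on power series in $q$ by $\left(\sum_{n\ge0}a(n)q^n\right)|U_2=\sum_{n\ge0}a(2n)q^n$. *)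

theory Defs
  imports "HOL-Analysis.Analysis" "HOL-Computational_Algebra.Computational_Algebra"
begin

text \<open>
  The indeterminate \<open>q\<close> is \<^term>\<open>fps_X\<close>.  The infinite products are limits of partial products in
  the \<open>q\<close>-adic topology on \<^typ>\<open>complex fps\<close> (the metric topology of that type).  Their factors are
  indexed from \<open>0\<close>, so the exponent \<open>n \<ge> 1\<close> of the usual product is \<^term>\<open>Suc n\<close> here.
\<close>

definition Phi2 :: "complex fps" where
  "Phi2 = (\<Prod>n. (1 - fps_X ^ (2 * Suc n)) / (1 - fps_X ^ Suc n) ^ 2)"

definition G2 :: "complex fps" where
  "G2 = fps_X * (\<Prod>n. ((1 - fps_X ^ (2 * Suc n)) / (1 - fps_X ^ Suc n)) ^ 24)"

definition G8 :: "complex fps" where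
  "G8 = fps_X *
     (\<Prod>n. ((1 - fps_X ^ (8 * Suc n)) ^ 4 * (1 - fps_X ^ (2 * Suc n)) ^ 2) /
           ((1 - fps_X ^ (4 * Suc n)) ^ 2 * (1 - fps_X ^ Suc n) ^ 4))"

definition U2 :: "'a fps \<Rightarrow> 'a fps" where
  "U2 f = Abs_fps (\<lambda>n. fps_nth f (2 * n))"

text \<open>The coefficient ring is left open so that \<open>P_poly\<close> can be evaluated at a power series.\<close>

definition P_poly :: "'a::comm_ring_1 poly" where
  "P_poly = [:0, 2 * 13, 2^3 * 403, 2^6 * 2015, 2^10 * 2431, 2^15 * 819,
         2^19 * 325, 2^22 * 151, 2^26 * 19, 2^30:]"

end

theory Submission
  imports Defs
begin

text \<open>
  Write \<open>\<theta>(q) = \<Sum>\<^sub>n q\<^bsup>n\<^sup>2\<^esup>\<close> (sum over all integers).  The three series are rational in \<open>\<theta>\<close>: with \<open>a = \<theta>(q)\<close> and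
  \<open>b = \<theta>(-q)\<close>,
  \<open>\<Phi>\<^sub>2(-q) = 1 / a\<close>, \<open>8 G\<^sub>8(q) = (a\<^sup>2 - b\<^sup>2) / b\<^sup>2\<close> and
  \<open>16 G\<^sub>2(-q) = - b\<^sup>4 (a\<^sup>4 - b\<^sup>4) / a\<^sup>8\<close>.
  On the other side, \<open>U\<^sub>2\<close> is averaging over \<open>q \<rightarrow> - q\<close> followed by \<open>q\<^sup>2 \<rightarrow> q\<close>, and \<open>q \<rightarrow> - q\<close> merely exchanges
  \<open>a\<close> and \<open>b\<close>.  So each left-hand side, taken at \<open>q\<^sup>2\<close>, is a symmetric rational function of \<open>a\<close> and \<open>b\<close>.
  The right-hand sides at \<open>q\<^sup>2\<close> are expressed through the same two series by the classical relations
  \<open>\<theta>(q) \<theta>(-q) = \<theta>(-q\<^sup>2)\<^sup>2\<close>, \<open>\<theta>(q)\<^sup>2 + \<theta>(-q)\<^sup>2 = 2 \<theta>(q\<^sup>2)\<^sup>2\<close> and \<open>\<theta>(q) + \<theta>(-q) = 2 \<theta>(q\<^sup>4)\<close>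
  (\<open>theta_product\<close>, \<open>theta_square_sum\<close>, \<open>theta_sum\<close>): they give \<open>16 a b G\<^sub>8(q\<^sup>2) = (a - b)\<^sup>2\<close> and
  \<open>\<Phi>\<^sub>2(-q\<^sup>4) = 2 / (a + b)\<close>.  All four claims thereby become polynomial identities in \<open>a\<close> and \<open>b\<close>
  (\<open>U2_identities_algebra\<close>).

  The theta relations rest on Gauss's product
  \<open>\<theta>(-q) = \<Prod>\<^sub>n (1 - q\<^sup>n) / (1 + q\<^sup>n)\<close>, obtained from a finite identity of Shanks (\<open>shanks_identity\<close>).
  The product makes \<open>theta_product\<close> a cancellation of factors, the series makes \<open>theta_sum\<close> a remark on squares,
  and everything else follows from these two by cancelling Euler products and by uniqueness for functional
  equations that relate a series in \<open>q\<close> to the same series in \<open>q\<^sup>2\<close> (\<open>fps_eq_0_of_self_similar\<close>,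
  \<open>self_similar_square_unique\<close>).
\<close>

section \<open>Limits, substitutions and products of power series\<close>

lemma tendsto_mult_fps:
  fixes f g :: "'b \<Rightarrow> 'a :: ring fps"
  assumes "(f \<longlongrightarrow> F) A" "(g \<longlongrightarrow> G) A"
  shows "((\<lambda>x. f x * g x) \<longlongrightarrow> F * G) A"
proof (rule tendsto_fpsI)
  fix n
  have "eventually (\<lambda>x. \<forall>i\<in>{..n}. fps_nth (f x) i = fps_nth F i) A"
    and "eventually (\<lambda>x. \<forall>i\<in>{..n}. fps_nth (g x) i = fps_nth G i) A"
    using assms by (auto simp: tendsto_fps_iff intro!: eventually_ball_finite)
  then show "eventually (\<lambda>x. fps_nth (f x * g x) n = fps_nth (F * G) n) A"
    by eventually_elim (auto simp: fps_mult_nth intro!: sum.cong)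
qed

lemma tendsto_power_fps:
  fixes f :: "'b \<Rightarrow> 'a :: comm_ring_1 fps"
  assumes "(f \<longlongrightarrow> F) A"
  shows "((\<lambda>x. f x ^ n) \<longlongrightarrow> F ^ n) A"
  by (induction n) (auto intro: tendsto_mult_fps assms)

lemma tendsto_divide_fps:
  fixes f g :: "'b \<Rightarrow> 'a :: field fps"
  assumes "(f \<longlongrightarrow> F) A" "(g \<longlongrightarrow> G) A" "fps_nth G 0 \<noteq> 0"
  shows "((\<lambda>x. f x / g x) \<longlongrightarrow> F / G) A"
proof -
  have "eventually (\<lambda>x. fps_nth (g x) 0 = fps_nth G 0) A"
    using assms(2) by (simp add: tendsto_fps_iff)
  then have ev: "eventually (\<lambda>x. f x * inverse (g x) = f x / g x) A"
    by eventually_elim (use assms(3) in \<open>simp add: fps_divide_unit\<close>)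
  have "((\<lambda>x. f x * inverse (g x)) \<longlongrightarrow> F * inverse G) A"
    by (intro tendsto_mult_fps assms tendsto_inverse_fps)
  then have "((\<lambda>x. f x / g x) \<longlongrightarrow> F * inverse G) A"
    by (rule Lim_transform_eventually[OF _ ev])
  then show ?thesis using assms(3) by (simp add: fps_divide_unit)
qed

lemma fps_nth_compose_X_power:
  fixes f :: "'a :: comm_ring_1 fps"
  assumes "k > 0"
  shows "fps_nth (f oo fps_X ^ k) n = (if k dvd n then fps_nth f (n div k) else 0)"
proof -
  have "fps_nth (f oo fps_X ^ k) n = (\<Sum>i=0..n. if n = k * i then fps_nth f i else 0)"
    by (auto simp: fps_compose_nth power_mult[symmetric] intro!: sum.cong)
  also have "\<dots> = (if k dvd n then fps_nth f (n div k) else 0)"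
  proof (cases "k dvd n")
    case True
    then obtain m where m: "n = k * m" by auto
    have "(\<Sum>i=0..n. if n = k * i then fps_nth f i else 0) = (\<Sum>i=0..n. if i = m then fps_nth f i else 0)"
      using assms m by (intro sum.cong) auto
    then show ?thesis using assms m by simp
  qed (auto intro!: sum.neutral)
  finally show ?thesis .
qed

lemma tendsto_compose_X_power:
  fixes f :: "'b \<Rightarrow> 'a :: comm_ring_1 fps"
  assumes "(f \<longlongrightarrow> F) A" "k > 0"
  shows "((\<lambda>x. f x oo fps_X ^ k) \<longlongrightarrow> (F oo fps_X ^ k)) A"
  using assms by (auto simp: tendsto_fps_iff fps_nth_compose_X_power)

lemma tendsto_compose_uminus_X:
  fixes f :: "'b \<Rightarrow> 'a :: comm_ring_1 fps"
  assumes "(f \<longlongrightarrow> F) A"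
  shows "((\<lambda>x. f x oo - fps_X) \<longlongrightarrow> (F oo - fps_X)) A"
  unfolding tendsto_fps_iff
proof
  fix n
  have "eventually (\<lambda>x. fps_nth (f x) n = fps_nth F n) A"
    using assms by (simp add: tendsto_fps_iff)
  then show "eventually (\<lambda>x. fps_nth (f x oo - fps_X) n = fps_nth (F oo - fps_X) n) A"
    by eventually_elim (simp add: fps_compose_uminus')
qed

lemma compose_uminus_X_twice:
  "(f oo - fps_X) oo - fps_X = (f :: 'a :: idom fps)"
  by (simp add: fps_eq_iff fps_compose_uminus' flip: mult.assoc power_mult_distrib)

lemma compose_X_even_power_uminus:
  fixes f :: "'a :: idom fps"
  assumes "even k" "k > 0"
  shows "(f oo fps_X ^ k) oo - fps_X = f oo fps_X ^ k"
  using assms by (auto simp: fps_eq_iff fps_compose_uminus' fps_nth_compose_X_power)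

lemma compose_uminus_X_power:
  fixes f :: "'a :: idom fps"
  assumes "k > 0"
  shows "(f oo - fps_X) oo fps_X ^ k = f oo - (fps_X ^ k)"
  using assms by (simp add: fps_compose_assoc[symmetric] fps_compose_uminus)

lemma compose_X_power_twice:
  fixes f :: "'a :: idom fps"
  assumes "k > 0" "m > 0"
  shows "(f oo fps_X ^ k) oo fps_X ^ m = f oo fps_X ^ (m * k)"
  using assms by (simp add: fps_compose_assoc[symmetric] fps_X_power_compose power_mult)

lemma prodinf_fps_eqI:
  fixes f :: "nat \<Rightarrow> complex fps"
  assumes "(\<lambda>n. \<Prod>i\<le>n. f i) \<longlonglongrightarrow> p" "p \<noteq> 0"
  shows "prodinf f = p"
proof -
  have "f has_prod p" using assms by (simp add: has_prod_def raw_has_prod_def)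
  then show ?thesis by (rule has_prod_unique[symmetric])
qed

lemma fps_nth_X_power_mult_less:
  "n < k \<Longrightarrow> fps_nth (f * fps_X ^ k) n = (0 :: 'a :: comm_ring_1)"
  by (simp add: fps_X_power_mult_right_nth)

lemma fps_nth_0_prod: "fps_nth (prod f S) 0 = (\<Prod>i\<in>S. fps_nth (f i) (0::nat) :: 'a :: comm_ring_1)"
  by (induction S rule: infinite_finite_induct) auto

lemma prod_fps_divide:
  fixes u v :: "nat \<Rightarrow> 'a :: field fps"
  assumes "\<And>i. fps_nth (v i) 0 \<noteq> 0"
  shows "(\<Prod>i\<le>n. u i / v i) = (\<Prod>i\<le>n. u i) / (\<Prod>i\<le>n. v i)"
proof -
  have "(\<Prod>i\<le>n. u i / v i) * (\<Prod>i\<le>n. v i) = (\<Prod>i\<le>n. u i)"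
    unfolding prod.distrib[symmetric] by (intro prod.cong) (use assms in \<open>auto simp: fps_divide_unit inverse_mult_eq_1 mult.assoc\<close>)
  moreover have "fps_nth (\<Prod>i\<le>n. v i) 0 \<noteq> 0"
    using assms by (simp add: fps_nth_0_prod)
  then have "(\<Prod>i\<le>n. v i) \<noteq> 0" by (metis fps_zero_nth)
  ultimately show ?thesis by (metis nonzero_mult_div_cancel_right)
qed

text \<open>
  The infinite products of the theorem are products of quotients.  Multiplying by the limit of the
  denominators avoids any quotient of infinite products in what follows.
\<close>

lemma prodinf_fps_divide:
  fixes u v :: "nat \<Rightarrow> complex fps"
  assumes "(\<lambda>n. \<Prod>i\<le>n. u i) \<longlonglongrightarrow> U" "(\<lambda>n. \<Prod>i\<le>n. v i) \<longlonglongrightarrow> V"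
    and "\<And>i. fps_nth (v i) 0 \<noteq> 0" "fps_nth U 0 \<noteq> 0" "fps_nth V 0 \<noteq> 0"
  shows "(\<Prod>n. u n / v n) * V = U"
proof -
  have V: "U / V * V = U"
    using assms(5) by (simp add: fps_divide_unit inverse_mult_eq_1 mult.assoc)
  moreover have "U \<noteq> 0" using assms(4) by auto
  ultimately have "U / V \<noteq> 0" by auto
  then have "(\<Prod>n. u n / v n) = U / V"
    using assms by (intro prodinf_fps_eqI) (auto simp: prod_fps_divide intro!: tendsto_divide_fps)
  with V show ?thesis by simp
qed

lemma fps_divide_power_unit:
  fixes u v :: "'a :: field fps"
  assumes "fps_nth v 0 \<noteq> 0"
  shows "(u / v) ^ n = u ^ n / v ^ n"
  using assms by (simp add: fps_divide_unit power_mult_distrib fps_inverse_power)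

section \<open>Euler's product and eta quotients\<close>

definition euler :: "complex fps" where
  "euler = (\<Prod>n. 1 - fps_X ^ Suc n)"

text \<open>
  The partial products stabilise: passing from \<open>n\<close> to \<open>n + 1\<close> changes only coefficients of index
  larger than \<open>n\<close>, so the diagonal of coefficients is the limit.
\<close>

lemma euler_tendsto: "(\<lambda>n. \<Prod>i\<le>n. 1 - fps_X ^ Suc i) \<longlonglongrightarrow> euler"
  and euler_nth_0 [simp]: "fps_nth euler 0 = 1"
proof -
  define P :: "nat \<Rightarrow> complex fps" where "P n = (\<Prod>i\<le>n. 1 - fps_X ^ Suc i)" for n
  define p where "p = Abs_fps (\<lambda>n. fps_nth (P n) n)"
  have stable: "fps_nth (P (n + k)) n = fps_nth (P n) n" for n k
  proof (induction k)
    case (Suc k)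
    have "P (n + Suc k) = P (n + k) - P (n + k) * fps_X ^ Suc (n + Suc k)"
      by (simp add: P_def algebra_simps)
    then have "fps_nth (P (n + Suc k)) n = fps_nth (P (n + k)) n"
      by (simp add: fps_nth_X_power_mult_less del: power_Suc)
    with Suc show ?case by simp
  qed simp
  have lim: "P \<longlonglongrightarrow> p"
  proof (rule tendsto_fpsI)
    fix n
    have "fps_nth (P m) n = fps_nth p n" if "m \<ge> n" for m
      using stable[of n "m - n"] that by (simp add: p_def)
    then show "eventually (\<lambda>m. fps_nth (P m) n = fps_nth p n) sequentially"
      by (auto simp: eventually_sequentially)
  qed
  have "fps_nth p 0 = 1" by (simp add: p_def P_def)
  moreover from this have "p \<noteq> 0" by auto
  moreover have "euler = p"
    unfolding euler_def by (rule prodinf_fps_eqI) (use lim \<open>p \<noteq> 0\<close> in \<open>simp_all add: P_def[abs_def]\<close>)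
  ultimately show "(\<lambda>n. \<Prod>i\<le>n. 1 - fps_X ^ Suc i) \<longlonglongrightarrow> euler" "fps_nth euler 0 = 1"
    using lim by (simp_all add: P_def[abs_def])
qed

lemma euler_compose_tendsto:
  assumes "k > 0"
  shows "(\<lambda>n. \<Prod>i\<le>n. 1 - fps_X ^ (k * Suc i)) \<longlonglongrightarrow> (euler oo fps_X ^ k)"
proof -
  have "(\<Prod>i\<le>n. 1 - fps_X ^ Suc i) oo fps_X ^ k = (\<Prod>i\<le>n. 1 - fps_X ^ (k * Suc i) :: complex fps)" for n
  proof -
    have z: "fps_nth (fps_X ^ k :: complex fps) 0 = 0" using assms by simp
    show ?thesis
      by (simp only: fps_compose_prod_distrib[OF z] fps_compose_sub_distrib fps_X_power_compose[OF z]
          power_mult fps_compose_1)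
  qed
  with tendsto_compose_X_power[OF euler_tendsto assms] show ?thesis by simp
qed

lemma euler_power_tendsto:
  "(\<lambda>n. \<Prod>i\<le>n. (1 - fps_X ^ Suc i) ^ m) \<longlonglongrightarrow> euler ^ m"
  "k > 0 \<Longrightarrow> (\<lambda>n. \<Prod>i\<le>n. (1 - fps_X ^ (k * Suc i)) ^ m) \<longlonglongrightarrow> (euler oo fps_X ^ k) ^ m"
  unfolding prod_power_distrib[symmetric]
  by (intro tendsto_power_fps euler_tendsto euler_compose_tendsto; simp)+

lemma euler_compose_neq_0 [simp]: "k > 0 \<Longrightarrow> euler oo fps_X ^ k \<noteq> 0" "euler \<noteq> 0"
proof -
  show e: "euler \<noteq> 0"
    using euler_nth_0 by (metis fps_zero_nth zero_neq_one)
  show "euler oo fps_X ^ k \<noteq> 0" if "k > 0"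
    using e that by (simp add: fps_compose_eq_0_iff)
qed

lemma Phi2_euler: "Phi2 * euler ^ 2 = euler oo fps_X ^ 2"
  unfolding Phi2_def
  by (rule prodinf_fps_divide)
     (use euler_power_tendsto(1)[of 2] euler_compose_tendsto[of 2] in simp_all)

lemma G2_euler: "G2 * euler ^ 24 = fps_X * (euler oo fps_X ^ 2) ^ 24"
proof -
  have "(\<Prod>n. ((1 - fps_X ^ (2 * Suc n)) / (1 - fps_X ^ Suc n)) ^ 24) * euler ^ 24 = (euler oo fps_X ^ 2) ^ 24"
    (is "(\<Prod>n. ?f n) * _ = _")
  proof -
    have "?f n = (1 - fps_X ^ (2 * Suc n)) ^ 24 / (1 - fps_X ^ Suc n) ^ 24" for n
      by (rule fps_divide_power_unit) simp
    moreover have "(\<Prod>n. (1 - fps_X ^ (2 * Suc n)) ^ 24 / (1 - fps_X ^ Suc n) ^ 24) * euler ^ 24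
        = (euler oo fps_X ^ 2) ^ 24"
      by (rule prodinf_fps_divide[OF euler_power_tendsto(2)[of 2] euler_power_tendsto(1)]) simp_all
    ultimately show ?thesis by (simp only:)
  qed
  then show ?thesis by (simp add: G2_def mult.assoc)
qed

lemma G8_euler:
  "G8 * ((euler oo fps_X ^ 4) ^ 2 * euler ^ 4)
   = fps_X * ((euler oo fps_X ^ 8) ^ 4 * (euler oo fps_X ^ 2) ^ 2)"
proof -
  have "(\<Prod>n. ((1 - fps_X ^ (8 * Suc n)) ^ 4 * (1 - fps_X ^ (2 * Suc n)) ^ 2) /
           ((1 - fps_X ^ (4 * Suc n)) ^ 2 * (1 - fps_X ^ Suc n) ^ 4)) *
      ((euler oo fps_X ^ 4) ^ 2 * euler ^ 4) = (euler oo fps_X ^ 8) ^ 4 * (euler oo fps_X ^ 2) ^ 2"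
    by (rule prodinf_fps_divide)
     (unfold prod.distrib, (intro tendsto_mult_fps euler_power_tendsto; simp)+, simp_all)
  then show ?thesis by (simp only: G8_def mult.assoc)
qed

section \<open>Gauss's product for the theta series\<close>

text \<open>
  Defined at \<open>0\<close> too, where it vanishes; this kills the lower boundary term of the telescoping sum
  in \<open>shanks_identity\<close>.
\<close>

definition gauss_factor :: "nat \<Rightarrow> complex fps" where
  "gauss_factor k = (1 - fps_X ^ k) * inverse (1 + fps_X ^ k)"

text \<open>
  The series \<open>\<theta>(q) = \<Sum>\<^sub>n q\<^bsup>n\<^sup>2\<^esup>\<close> over all integers \<open>n\<close>, which hits every positive square twice.
  Jacobi's \<open>\<theta>\<^sub>4\<close> is its value at \<open>- q\<close>.
\<close>

definition theta3 :: "complex fps" where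
  "theta3 = Abs_fps (\<lambda>n. if n = 0 then 1 else if \<exists>k. n = k ^ 2 then 2 else 0)"

lemma theta_nth [simp]: "fps_nth theta3 0 = 1" "fps_nth theta3 (Suc 0) = 2"
  by (auto simp: theta3_def intro!: exI[of _ 1])

text \<open>
  The finite form of Gauss's theta identity, in the style of Shanks.  The difference of the left-hand
  sides for \<open>n + 1\<close> and \<open>n\<close> telescopes in \<open>s\<close>; its upper boundary term and the term \<open>s = n + 1\<close> add up to the new
  summand on the right.  The powers \<open>q\<^bsup>s (n + 1)\<^esup>\<close> make every term except \<open>s = 0\<close> negligible as \<open>n\<close> grows.
\<close>

lemma shanks_identity:
  "(\<Sum>s\<le>n. (-1) ^ s * 2 * inverse (1 + fps_X ^ s) * (\<Prod>k\<in>{s<..n}. gauss_factor k) * fps_X ^ (s * (n + 1)))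
   = 1 + 2 * (\<Sum>s=1..n. (-1) ^ s * fps_X ^ (s ^ 2) :: complex fps)"
proof -
  define c :: "nat \<Rightarrow> complex fps" where "c k = inverse (1 + fps_X ^ k)" for k
  have c: "c k * (1 + fps_X ^ k) = 1" for k
    unfolding c_def by (rule inverse_mult_eq_1) (simp add: fps_X_power_nth)
  \<comment> \<open>this rule and the next make all terms polynomial in the \<open>c k\<close>, so that no denominators remain\<close>
  have Xc: "fps_X ^ k * c k = 1 - c k" for k
    using c[of k] by (simp add: algebra_simps)
  have p: "gauss_factor k = 2 * c k - 1" for k
    using Xc[of k] by (simp add: gauss_factor_def c_def[symmetric] algebra_simps)
  define A where "A n s = (-1) ^ s * 2 * c s * (\<Prod>k\<in>{s<..n}. gauss_factor k) * fps_X ^ (s * (n + 1))" for n s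
  have "(\<Sum>s\<le>n. A n s) = 1 + 2 * (\<Sum>s=1..n. (-1) ^ s * fps_X ^ (s ^ 2))"
  proof (induction n)
    case 0
    have "2 * c 0 = 1" using c[of 0] by (simp add: mult.commute)
    then show ?case by (simp add: A_def)
  next
    case (Suc n)
    \<comment> \<open>the certificate of the telescoping sum\<close>
    define G where "G s = (-1) ^ s * 2 * c (Suc n) * (\<Prod>k\<in>{s..n}. gauss_factor k) * fps_X ^ (s * Suc n)" for s
    have step: "A (Suc n) s - A n s = G (Suc s) - G s" if "s \<le> n" for s
    proof -
      define Q where "Q = (\<Prod>k\<in>{s<..n}. gauss_factor k)"
      have 1: "(\<Prod>k\<in>{s<..Suc n}. gauss_factor k) = gauss_factor (Suc n) * Q"
      proof -
        have "{s<..Suc n} = insert (Suc n) {s<..n}" using that by auto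
        then show ?thesis by (simp add: Q_def)
      qed
      have 2: "(\<Prod>k\<in>{s..n}. gauss_factor k) = gauss_factor s * Q"
      proof -
        have "{s..n} = insert s {s<..n}" using that by auto
        then show ?thesis by (simp add: Q_def)
      qed
      have 3: "(\<Prod>k\<in>{Suc s..n}. gauss_factor k) = Q"
        by (simp add: Q_def atLeastSucAtMost_greaterThanAtMost)
      have core: "c s * (gauss_factor (Suc n) * fps_X ^ s - 1) = - c (Suc n) * fps_X ^ Suc n - c (Suc n) * gauss_factor s"
      proof -
        have "c s * (gauss_factor (Suc n) * fps_X ^ s - 1) = gauss_factor (Suc n) * (fps_X ^ s * c s) - c s"
          by (simp add: algebra_simps)
        also have "\<dots> = (2 * c (Suc n) - 1) * (1 - c s) - c s" by (simp only: Xc p)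
        also have "\<dots> = - (1 - c (Suc n)) - c (Suc n) * (2 * c s - 1)" by (simp add: algebra_simps)
        also have "\<dots> = - (fps_X ^ Suc n * c (Suc n)) - c (Suc n) * gauss_factor s" by (simp only: Xc p)
        finally show ?thesis by (simp add: algebra_simps)
      qed
      have "A (Suc n) s - A n s = (-1) ^ s * 2 * Q * fps_X ^ (s * Suc n) * (c s * (gauss_factor (Suc n) * fps_X ^ s - 1))"
        unfolding A_def 1 Q_def[symmetric] by (simp add: algebra_simps power_add)
      also have "\<dots> = G (Suc s) - G s"
        unfolding core G_def 2 3 by (simp add: algebra_simps power_add)
      finally show ?thesis .
    qed
    have "(\<Sum>s\<le>n. A (Suc n) s) - (\<Sum>s\<le>n. A n s) = (\<Sum>s\<le>n. G (Suc s) - G s)"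
      unfolding sum_subtractf[symmetric] by (intro sum.cong) (auto simp: step)
    also have "\<dots> = G (Suc n) - G 0" by (simp only: lessThan_Suc_atMost[symmetric] sum_lessThan_telescope)
    also have "G 0 = 0"
    proof -
      have "(\<Prod>k\<in>{0..n}. gauss_factor k) = 0"
        by (rule prod_zero) (auto simp: gauss_factor_def intro!: bexI[of _ 0])
      then show ?thesis by (simp add: G_def)
    qed
    finally have "(\<Sum>s\<le>Suc n. A (Suc n) s) = (\<Sum>s\<le>n. A n s) + (G (Suc n) + A (Suc n) (Suc n))"
      by (simp add: algebra_simps)
    also have "G (Suc n) + A (Suc n) (Suc n)
        = 2 * ((-1) ^ Suc n * fps_X ^ (Suc n ^ 2)) * (c (Suc n) * (1 + fps_X ^ Suc n))"
      by (simp add: G_def A_def algebra_simps power_add power2_eq_square)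
    also have "\<dots> = 2 * ((-1) ^ Suc n * fps_X ^ (Suc n ^ 2))" by (simp only: c mult_1_right)
    also note Suc
    finally show ?case by (simp add: algebra_simps)
  qed
  then show ?thesis by (simp add: A_def c_def)
qed

lemma fps_nth_theta4:
  "fps_nth (theta3 oo - fps_X) n = (if n = 0 then 1 else if \<exists>k. n = k ^ 2 then 2 * (-1) ^ n else 0)"
  by (simp add: fps_compose_uminus' theta3_def)

lemma theta4_partial_sum:
  assumes "m \<le> n"
  shows "fps_nth (1 + 2 * (\<Sum>s=1..n. (-1) ^ s * fps_X ^ (s ^ 2))) m = fps_nth (theta3 oo - fps_X) m"
proof -
  have "fps_nth (2 * (\<Sum>s=1..n. (-1) ^ s * fps_X ^ (s ^ 2))) m
      = 2 * (\<Sum>s=1..n. if m = s ^ 2 then (-1) ^ s else (0::complex))"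
  proof -
    have "fps_nth ((-1) ^ s * fps_X ^ (s ^ 2)) m = (if m = s ^ 2 then (-1) ^ s else (0::complex))" for s :: nat
      by (cases "even s") (simp_all add: fps_X_power_nth)
    then show ?thesis
      by (simp add: fps_sum_nth fps_mult_numeral_left)
  qed
  also have "(\<Sum>s=1..n. if m = s ^ 2 then (-1) ^ s else (0::complex))
      = (if m > 0 \<and> (\<exists>k. m = k ^ 2) then (-1) ^ m else 0)"
  proof (cases "m > 0 \<and> (\<exists>k. m = k ^ 2)")
    case True
    then obtain k where k: "m = k ^ 2" "k > 0" by auto
    then have "k \<le> m" by (simp add: power2_eq_square)
    have "(\<Sum>s=1..n. if m = s ^ 2 then (-1) ^ s else (0::complex)) = (\<Sum>s=1..n. if s = k then (-1) ^ s else 0)"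
      by (intro sum.cong) (auto simp: k)
    also have "\<dots> = (-1) ^ k" using k \<open>k \<le> m\<close> assms by auto
    also have "\<dots> = (-1) ^ m" using k by (cases "even k") auto
    finally show ?thesis using True by simp
  next
    case False
    then show ?thesis by (auto intro!: sum.neutral)
  qed
  finally show ?thesis by (auto simp: fps_nth_theta4)
qed

text \<open>
  Gauss's identity \<open>\<theta>(-q) = \<Prod>\<^sub>k (1 - q\<^sup>k) / (1 + q\<^sup>k)\<close>: up to \<open>q\<^sup>n\<close>, the term \<open>s = 0\<close> is all that remains
  on the left of \<open>shanks_identity\<close>.
\<close>

lemma gauss_tendsto: "(\<lambda>n. \<Prod>k\<in>{0<..n}. gauss_factor k) \<longlonglongrightarrow> (theta3 oo - fps_X)"
proof (rule tendsto_fpsI)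
  fix m
  have "fps_nth (\<Prod>k\<in>{0<..n}. gauss_factor k) m = fps_nth (theta3 oo - fps_X) m" if "m \<le> n" for n
  proof -
    define A :: "nat \<Rightarrow> complex fps" where
      "A s = (-1) ^ s * 2 * inverse (1 + fps_X ^ s) * (\<Prod>k\<in>{s<..n}. gauss_factor k)" for s
    have "fps_nth (theta3 oo - fps_X) m = fps_nth (\<Sum>s\<le>n. A s * fps_X ^ (s * (n + 1))) m"
      using theta4_partial_sum[OF that] shanks_identity[of n] by (simp add: A_def)
    also have "\<dots> = (\<Sum>s\<le>n. if s = 0 then fps_nth (A 0) m else 0)"
      unfolding fps_sum_nth
    proof (intro sum.cong refl)
      fix s
      have "m < s * (n + 1)" if "s \<noteq> 0" using \<open>m \<le> n\<close> that by (cases s) auto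
      then show "fps_nth (A s * fps_X ^ (s * (n + 1))) m = (if s = 0 then fps_nth (A 0) m else 0)"
        by (auto simp: fps_nth_X_power_mult_less)
    qed
    also have "\<dots> = fps_nth (A 0) m" by simp
    also have "A 0 = (2 * inverse 2) * (\<Prod>k\<in>{0<..n}. gauss_factor k)"
      by (simp add: A_def)
    also have "(2::complex fps) * inverse 2 = 1"
      by (subst mult.commute, rule inverse_mult_eq_1) simp
    finally show ?thesis by simp
  qed
  then show "eventually (\<lambda>n. fps_nth (\<Prod>k\<in>{0<..n}. gauss_factor k) m = fps_nth (theta3 oo - fps_X) m) sequentially"
    by (auto simp: eventually_sequentially)
qed

text \<open>
  Gauss's identity as an eta quotient, since
  \<open>(1 - q\<^sup>k) / (1 + q\<^sup>k) = (1 - q\<^sup>k)\<^sup>2 / (1 - q\<^bsup>2k\<^esup>)\<close>.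
\<close>

lemma euler_square: "euler ^ 2 = (theta3 oo - fps_X) * (euler oo fps_X ^ 2)"
proof (rule LIMSEQ_unique)
  have "(\<Prod>i\<le>n. 1 - fps_X ^ Suc i) ^ 2 = (\<Prod>k\<in>{0<..Suc n}. gauss_factor k) * (\<Prod>i\<le>n. 1 - fps_X ^ (2 * Suc i))" for n
  proof -
    have "(\<Prod>k\<in>{0<..Suc n}. gauss_factor k) = (\<Prod>i\<le>n. gauss_factor (Suc i))"
      by (rule prod.reindex_bij_witness[of _ Suc "\<lambda>k. k - 1"]) auto
    moreover have "(1 - fps_X ^ Suc i) ^ 2 = gauss_factor (Suc i) * (1 - fps_X ^ (2 * Suc i))" for i
    proof -
      have "inverse (1 + fps_X ^ Suc i) * (1 + fps_X ^ Suc i) = (1 :: complex fps)"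
        by (rule inverse_mult_eq_1) simp
      then have "gauss_factor (Suc i) * (1 + fps_X ^ Suc i) = 1 - fps_X ^ Suc i"
        by (simp only: gauss_factor_def mult.assoc mult_1_right)
      moreover have "(1 - fps_X ^ (2 * Suc i) :: complex fps) = (1 + fps_X ^ Suc i) * (1 - fps_X ^ Suc i)"
        by (simp only: mult_2 power_add ring_distribs mult_1_left mult_1_right) (simp only: algebra_simps)
      ultimately show ?thesis by (simp only: mult.assoc[symmetric] power2_eq_square)
    qed
    ultimately show ?thesis
      by (simp only: prod_power_distrib prod.distrib)
  qed
  moreover have "(\<lambda>n. (\<Prod>k\<in>{0<..Suc n}. gauss_factor k) * (\<Prod>i\<le>n. 1 - fps_X ^ (2 * Suc i)))
      \<longlonglongrightarrow> (theta3 oo - fps_X) * (euler oo fps_X ^ 2)"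
    by (intro tendsto_mult_fps LIMSEQ_Suc[OF gauss_tendsto] euler_compose_tendsto) simp
  ultimately show "(\<lambda>n. (\<Prod>i\<le>n. 1 - fps_X ^ Suc i) ^ 2) \<longlonglongrightarrow> (theta3 oo - fps_X) * (euler oo fps_X ^ 2)"
    by simp
qed (intro tendsto_power_fps euler_tendsto)

lemma euler_square_compose:
  assumes "k > 0"
  shows "(euler oo fps_X ^ k) ^ 2 = (theta3 oo - (fps_X ^ k)) * (euler oo fps_X ^ (2 * k))"
proof -
  have z: "fps_nth (fps_X ^ k :: complex fps) 0 = 0" using assms by simp
  have "euler ^ 2 oo fps_X ^ k = ((theta3 oo - fps_X) * (euler oo fps_X ^ 2)) oo fps_X ^ k"
    by (simp only: euler_square)
  then show ?thesis
    using assms by (simp add: fps_compose_power[OF z] fps_compose_mult_distrib[OF z] compose_uminus_X_power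
        compose_X_power_twice mult.commute)
qed

section \<open>Relations between theta series\<close>

text \<open>
  For odd \<open>k\<close> the substitution \<open>q \<rightarrow> - q\<close> swaps numerator and denominator.
\<close>

lemma gauss_factor_odd:
  assumes "odd k"
  shows "gauss_factor k * (gauss_factor k oo - fps_X) = 1"
proof -
  have k: "k > 0" using assms by (cases k) auto
  have 1: "inverse (1 + fps_X ^ k) * (1 + fps_X ^ k) = (1 :: complex fps)"
    by (rule inverse_mult_eq_1) (use k in simp)
  have 2: "inverse (1 - fps_X ^ k) * (1 - fps_X ^ k) = (1 :: complex fps)"
    by (rule inverse_mult_eq_1) (use k in simp)
  have "gauss_factor k oo - fps_X = (1 + fps_X ^ k) * inverse (1 - fps_X ^ k)"
    using k assms by (simp add: gauss_factor_def fps_compose_mult_distrib fps_inverse_compose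
        fps_compose_add_distrib fps_compose_sub_distrib fps_X_power_compose)
  then have "gauss_factor k * (gauss_factor k oo - fps_X)
      = (inverse (1 + fps_X ^ k) * (1 + fps_X ^ k)) * (inverse (1 - fps_X ^ k) * (1 - fps_X ^ k))"
    by (simp add: gauss_factor_def mult_ac)
  then show ?thesis by (simp only: 1 2 mult_1_left)
qed

lemma gauss_factor_compose:
  assumes "k > 0" "m > 0"
  shows "gauss_factor k oo fps_X ^ m = gauss_factor (m * k)"
  using assms by (simp add: gauss_factor_def fps_compose_mult_distrib fps_inverse_compose
      fps_compose_add_distrib fps_compose_sub_distrib fps_X_power_compose power_mult)

text \<open>
  In Gauss's product for \<open>\<theta>(-q)\<close> times its image under \<open>q \<rightarrow> - q\<close>, the odd factors cancel
  (\<open>gauss_factor_odd\<close>), while the even ones are fixed and form the product in \<open>q\<^sup>2\<close>, squared.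
\<close>

lemma theta_product: "theta3 * (theta3 oo - fps_X) = (theta3 oo - (fps_X ^ 2)) ^ 2"
proof -
  define P where "P n = (\<Prod>k\<in>{0<..n}. gauss_factor k)" for n
  have P: "P \<longlonglongrightarrow> (theta3 oo - fps_X)"
    using gauss_tendsto by (simp add: P_def[abs_def])
  have P_Suc: "P (Suc n) = P n * gauss_factor (Suc n)" for n
  proof -
    have "{0<..Suc n} = insert (Suc n) {0<..n}" by auto
    then show ?thesis by (simp add: P_def mult.commute)
  qed
  have eq: "P (2 * n) * (P (2 * n) oo - fps_X) = (P n oo fps_X ^ 2) ^ 2" for n
  proof (induction n)
    case 0
    then show ?case by (simp add: P_def)
  next
    case (Suc n)
    define g h where "g = gauss_factor (Suc (2 * n))" and "h = gauss_factor (2 * Suc n)"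
    have hc: "h = gauss_factor (Suc n) oo fps_X ^ 2"
      by (simp add: h_def gauss_factor_compose)
    have P2: "P (2 * Suc n) = P (2 * n) * g * h"
      using P_Suc[of "2 * n"] P_Suc[of "Suc (2 * n)"] by (simp add: g_def h_def)
    have h': "h oo - fps_X = h"
      unfolding hc by (rule compose_X_even_power_uminus) simp_all
    have "P (2 * Suc n) * (P (2 * Suc n) oo - fps_X)
        = (P (2 * n) * (P (2 * n) oo - fps_X)) * (g * (g oo - fps_X)) * h ^ 2"
      unfolding P2 by (simp add: fps_compose_mult_distrib h' power2_eq_square mult_ac)
    also have "\<dots> = (P n oo fps_X ^ 2) ^ 2 * h ^ 2"
      by (simp add: Suc g_def gauss_factor_odd)
    also have "\<dots> = (P (Suc n) oo fps_X ^ 2) ^ 2"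
      by (simp only: P_Suc hc) (simp add: fps_compose_mult_distrib power_mult_distrib)
    finally show ?case .
  qed
  have sub: "(\<lambda>n. P (2 * n)) \<longlonglongrightarrow> (theta3 oo - fps_X)"
    using LIMSEQ_subseq_LIMSEQ[OF P, of "\<lambda>n. 2 * n"] by (simp add: strict_mono_def o_def)
  have "(\<lambda>n. (P n oo fps_X ^ 2) ^ 2) \<longlonglongrightarrow> ((theta3 oo - fps_X) oo fps_X ^ 2) ^ 2"
    by (intro tendsto_power_fps tendsto_compose_X_power P) simp
  moreover have "(\<lambda>n. (P n oo fps_X ^ 2) ^ 2) \<longlonglongrightarrow> (theta3 oo - fps_X) * ((theta3 oo - fps_X) oo - fps_X)"
    unfolding eq[symmetric] by (intro tendsto_mult_fps tendsto_compose_uminus_X sub)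
  ultimately show ?thesis
    by (simp add: LIMSEQ_unique compose_uminus_X_twice compose_uminus_X_power mult.commute)
qed

text \<open>
  Averaging over \<open>q \<rightarrow> - q\<close> keeps the even squares, which are the \<open>4 j\<^sup>2\<close>.
\<close>

lemma theta_sum: "theta3 + (theta3 oo - fps_X) = 2 * (theta3 oo fps_X ^ 4)"
proof (rule fps_ext)
  fix n :: nat
  have "4 dvd n \<and> (\<exists>k. n div 4 = k ^ 2)" if "even n" "n = k ^ 2" for k
  proof -
    from that obtain j where "k = 2 * j" by auto
    with \<open>n = k ^ 2\<close> have "n = 4 * j ^ 2" by (simp add: power_mult_distrib)
    then show ?thesis by auto
  qed
  moreover have "\<exists>k. n = k ^ 2" if "4 dvd n" "n div 4 = k ^ 2" for k
  proof -
    from that have "n = (2 * k) ^ 2" by (auto simp: power_mult_distrib)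
    then show ?thesis by blast
  qed
  ultimately have "even n \<Longrightarrow> (\<exists>k. n = k ^ 2) \<longleftrightarrow> 4 dvd n \<and> (\<exists>k. n div 4 = k ^ 2)"
    by blast
  moreover have "4 dvd n \<Longrightarrow> even n" by auto
  moreover have "odd n \<Longrightarrow> n > 0" by (cases n) auto
  ultimately show "fps_nth (theta3 + (theta3 oo - fps_X)) n = fps_nth (2 * (theta3 oo fps_X ^ 4)) n"
    by (cases "even n") (auto simp: fps_compose_uminus' fps_nth_compose_X_power
        fps_mult_numeral_left theta3_def)
qed

text \<open>
  The coefficient of index \<open>n\<close> is a multiple of the one of index \<open>n / 2\<close>, or zero for odd \<open>n\<close>, so everything descends to the
  constant term, which is zero because \<open>c \<noteq> 1\<close>.
\<close>

lemma fps_eq_0_of_self_similar: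
  fixes D :: "complex fps"
  assumes "D = fps_const c * (D oo fps_X ^ 2)" "c \<noteq> 1"
  shows "D = 0"
proof (rule fps_ext)
  fix n show "fps_nth D n = fps_nth 0 n"
  proof (induction n rule: less_induct)
    case (less n)
    have *: "fps_nth D n = c * (if even n then fps_nth D (n div 2) else 0)"
      by (subst assms(1)) (simp add: fps_nth_compose_X_power)
    show ?case
    proof (cases "n = 0")
      case True
      with * have "(1 - c) * fps_nth D 0 = 0" by (simp add: algebra_simps)
      with assms(2) True show ?thesis by simp
    next
      case False
      then have "fps_nth D (n div 2) = 0" using less[of "n div 2"] by simp
      with * show ?thesis by simp
    qed
  qed
qed

text \<open>
  The defect \<open>D(q)\<close> of this relation satisfies \<open>D(q) = - 2 D(q\<^sup>2)\<close>: expand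
  \<open>(\<theta>(q) + \<theta>(-q))\<^sup>2 = 4 \<theta>(q\<^sup>4)\<^sup>2\<close> and replace the mixed term by \<open>theta_product\<close>.
\<close>

lemma theta_square_sum:
  "theta3 ^ 2 + (theta3 oo - fps_X) ^ 2 = 2 * (theta3 oo fps_X ^ 2) ^ 2"
proof -
  let ?a = theta3 and ?b = "theta3 oo - fps_X" and ?A = "theta3 oo fps_X ^ 2"
    and ?B = "theta3 oo - (fps_X ^ 2)" and ?C = "theta3 oo fps_X ^ 4"
  define D where "D = ?a ^ 2 + ?b ^ 2 - 2 * ?A ^ 2"
  have D2: "D oo fps_X ^ 2 = ?A ^ 2 + ?B ^ 2 - 2 * ?C ^ 2"
    unfolding D_def by (simp add: fps_compose_add_distrib fps_compose_sub_distrib fps_compose_mult_distrib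
        fps_compose_power compose_uminus_X_power compose_X_power_twice)
  have "D = (?a + ?b) ^ 2 - 2 * (?a * ?b) - 2 * ?A ^ 2"
    by (simp add: D_def power2_eq_square algebra_simps)
  also have "\<dots> = 4 * ?C ^ 2 - 2 * ?B ^ 2 - 2 * ?A ^ 2"
    by (simp only: theta_sum theta_product) (simp add: power_mult_distrib)
  also have "\<dots> = - 2 * (D oo fps_X ^ 2)"
    unfolding D2 by (simp add: algebra_simps)
  finally have "D = fps_const (-2) * (D oo fps_X ^ 2)"
    by (simp add: numeral_fps_const flip: fps_const_neg)
  then have "D = 0" by (rule fps_eq_0_of_self_similar) simp
  then show ?thesis by (simp add: D_def)
qed

section \<open>The three series in terms of theta series\<close>

text \<open>
  The eta quotient of \<open>\<theta>(q)\<close>, read off from \<open>\<theta>(q) = \<theta>(-q\<^sup>2)\<^sup>2 / \<theta>(-q)\<close>.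
\<close>

lemma theta3_euler: "theta3 * (euler ^ 2 * (euler oo fps_X ^ 4) ^ 2) = (euler oo fps_X ^ 2) ^ 5"
proof -
  let ?e = "\<lambda>k. euler oo fps_X ^ k"
  have "theta3 * (euler ^ 2 * ?e 4 ^ 2) = theta3 * (theta3 oo - fps_X) * ?e 2 * ?e 4 ^ 2"
    by (simp add: euler_square mult_ac)
  also have "\<dots> = ((theta3 oo - (fps_X ^ 2)) * ?e 4) ^ 2 * ?e 2"
    by (simp add: theta_product power_mult_distrib mult_ac)
  also have "\<dots> = (?e 2 ^ 2) ^ 2 * ?e 2"
    using euler_square_compose[of 2] by simp
  finally show ?thesis by (simp add: eval_nat_numeral mult_ac)
qed

lemma Phi2_theta: "Phi2 * (theta3 oo - fps_X) = 1"
proof -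
  have "(Phi2 * (theta3 oo - fps_X)) * (euler oo fps_X ^ 2) = 1 * (euler oo fps_X ^ 2)"
    using Phi2_euler euler_square by (simp add: mult.assoc)
  then show ?thesis by (simp only: mult_cancel_right) simp
qed

text \<open>
  This exhibits \<open>G\<^sub>8(q) \<theta>(-q)\<^sup>2\<close> as \<open>q \<psi>(q\<^sup>4)\<^sup>2\<close> for Ramanujan's
  \<open>\<psi>(q) = \<Prod>\<^sub>n (1 - q\<^bsup>2n\<^esup>)\<^sup>2 / (1 - q\<^sup>n)\<close>.
\<close>

lemma G8_theta4: "G8 * (theta3 oo - fps_X) ^ 2 * (euler oo fps_X ^ 4) ^ 2 = fps_X * (euler oo fps_X ^ 8) ^ 4"
proof -
  let ?e = "\<lambda>k. euler oo fps_X ^ k"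
  have "(G8 * (theta3 oo - fps_X) ^ 2 * ?e 4 ^ 2) * ?e 2 ^ 2 = G8 * (?e 4 ^ 2 * (euler ^ 2) ^ 2)"
    by (simp add: euler_square power_mult_distrib mult_ac)
  also have "\<dots> = G8 * (?e 4 ^ 2 * euler ^ 4)"
    by (simp flip: power_mult)
  also have "\<dots> = (fps_X * ?e 8 ^ 4) * ?e 2 ^ 2"
    using G8_euler by (simp add: mult_ac)
  finally show ?thesis by simp
qed

text \<open>
  If \<open>E \<noteq> H\<close>, subtracting the equations gives \<open>(E - H) (E + H) = C \<cdot> (E - H)(q\<^sup>2)\<close>.  Comparing orders of
  vanishing, with \<open>E + H\<close> of order \<open>1\<close>, forces \<open>E - H\<close> to have order \<open>1\<close>; but the coefficients of \<open>q\<close> agree.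
\<close>

lemma self_similar_square_unique:
  fixes E H C :: "complex fps"
  assumes E: "E ^ 2 = C * (E oo fps_X ^ 2)" and H: "H ^ 2 = C * (H oo fps_X ^ 2)"
    and C: "fps_nth C 0 \<noteq> 0"
    and 0: "fps_nth E 0 = 0" "fps_nth H 0 = 0"
    and 1: "fps_nth E 1 = fps_nth H 1" "fps_nth H 1 \<noteq> 0"
  shows "E = H"
proof (rule ccontr)
  assume "E \<noteq> H"
  then have W: "E - H \<noteq> 0" by simp
  have S: "subdegree (E + H) = 1"
    by (rule subdegreeI) (use 0 1 in auto)
  then have S0: "E + H \<noteq> 0" by auto
  have "(E - H) * (E + H) = C * ((E - H) oo fps_X ^ 2)"
    using E H by (simp add: fps_compose_sub_distrib algebra_simps power2_eq_square)
  moreover have "subdegree ((E - H) * (E + H)) = subdegree (E - H) + 1"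
    using W S0 S by simp
  moreover have "(E - H) oo fps_X ^ 2 \<noteq> 0" "C \<noteq> 0" 
    using W C by (auto simp: fps_compose_eq_0_iff)
  then have "subdegree (C * ((E - H) oo fps_X ^ 2)) = 2 * subdegree (E - H)"
    using C by (simp add: subdegree_eq_0)
  ultimately have "subdegree (E - H) = 1" by simp
  then have "fps_nth (E - H) 1 \<noteq> 0" using W nth_subdegree_nonzero by metis
  with 1 show False by simp
qed

text \<open>
  Classically \<open>\<theta>(q)\<^sup>2 - \<theta>(-q)\<^sup>2 = 8 q \<psi>(q\<^sup>4)\<^sup>2\<close>.  A series for \<open>\<psi>\<close> is avoided: both sides solve
  \<open>F(q)\<^sup>2 = 8 \<theta>(q\<^sup>4)\<^sup>2 F(q\<^sup>2)\<close> with leading term \<open>8 q\<close>, the left one by the quadratic relations for \<open>\<theta>\<close> and the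
  right one as an identity of eta quotients.
\<close>

lemma G8_theta: "8 * G8 * (theta3 oo - fps_X) ^ 2 = theta3 ^ 2 - (theta3 oo - fps_X) ^ 2"
proof -
  let ?a = theta3 and ?b = "theta3 oo - fps_X" and ?A = "theta3 oo fps_X ^ 2"
    and ?B = "theta3 oo - (fps_X ^ 2)" and ?C = "theta3 oo fps_X ^ 4"
  let ?e = "\<lambda>k. euler oo fps_X ^ k"
  define E where "E = ?a ^ 2 - ?b ^ 2"
  define H where "H = 8 * G8 * ?b ^ 2"
  have H: "H * ?e 4 ^ 2 = 8 * fps_X * ?e 8 ^ 4"
    using G8_theta4 by (simp add: H_def mult_ac)
  have H2: "(H oo fps_X ^ 2) * ?e 8 ^ 2 = 8 * fps_X ^ 2 * ?e 16 ^ 4"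
  proof -
    have "(H * ?e 4 ^ 2) oo fps_X ^ 2 = (8 * fps_X * ?e 8 ^ 4) oo fps_X ^ 2"
      by (simp only: H)
    then show ?thesis
      by (simp add: fps_compose_mult_distrib fps_compose_power compose_X_power_twice)
  qed
  have C: "?C * (?e 4 ^ 2 * ?e 16 ^ 2) = ?e 8 ^ 5"
  proof -
    have "(theta3 * (euler ^ 2 * ?e 4 ^ 2)) oo fps_X ^ 4 = (?e 2 ^ 5) oo fps_X ^ 4"
      by (simp only: theta3_euler)
    then show ?thesis
      by (simp add: fps_compose_mult_distrib fps_compose_power compose_X_power_twice)
  qed
  have HH: "H ^ 2 = 8 * ?C ^ 2 * (H oo fps_X ^ 2)"
  proof -
    have "(8 * ?C ^ 2 * (H oo fps_X ^ 2)) * (?e 8 ^ 2 * ?e 4 ^ 4 * ?e 16 ^ 4)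
        = 8 * (?C * (?e 4 ^ 2 * ?e 16 ^ 2)) ^ 2 * ((H oo fps_X ^ 2) * ?e 8 ^ 2)"
      by (simp add: power_mult_distrib mult_ac flip: power_mult)
    also have "\<dots> = 64 * fps_X ^ 2 * ?e 8 ^ 10 * ?e 16 ^ 4"
      unfolding C H2 by (simp add: mult_ac flip: power_mult)
    also have "\<dots> = (8 * fps_X * ?e 8 ^ 4) ^ 2 * ?e 8 ^ 2 * ?e 16 ^ 4"
      by (simp add: power_mult_distrib mult_ac flip: power_mult power_add)
    also have "\<dots> = H ^ 2 * (?e 8 ^ 2 * ?e 4 ^ 4 * ?e 16 ^ 4)"
      unfolding H[symmetric] by (simp add: power_mult_distrib mult_ac flip: power_mult)
    finally show ?thesis by simp
  qed
  have EE: "E ^ 2 = 8 * ?C ^ 2 * (E oo fps_X ^ 2)"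
  proof -
    have E2: "E oo fps_X ^ 2 = ?A ^ 2 - ?B ^ 2"
      by (simp add: E_def fps_compose_sub_distrib fps_compose_power compose_uminus_X_power)
    have "?A ^ 2 + ?B ^ 2 = 2 * ?C ^ 2"
    proof -
      have "(theta3 ^ 2 + ?b ^ 2) oo fps_X ^ 2 = (2 * ?A ^ 2) oo fps_X ^ 2"
        by (simp only: theta_square_sum)
      then show ?thesis
        by (simp add: fps_compose_mult_distrib fps_compose_add_distrib fps_compose_power
            compose_X_power_twice compose_uminus_X_power)
    qed
    then have "8 * ?C ^ 2 * (E oo fps_X ^ 2) = 4 * (?A ^ 2 + ?B ^ 2) * (?A ^ 2 - ?B ^ 2)"
      by (simp add: E2)
    also have "\<dots> = (2 * ?A ^ 2) ^ 2 - 4 * (?B ^ 2) ^ 2"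
      by (simp add: power2_eq_square algebra_simps)
    also have "\<dots> = (?a ^ 2 + ?b ^ 2) ^ 2 - 4 * (?a * ?b) ^ 2"
      by (simp only: theta_square_sum theta_product)
    also have "\<dots> = E ^ 2"
      by (simp add: E_def power2_eq_square algebra_simps)
    finally show ?thesis ..
  qed
  have "E = H"
  proof (rule self_similar_square_unique[OF EE HH])
    have b: "fps_nth ?b 0 = 1" "fps_nth ?b (Suc 0) = -2"
      by (simp_all add: fps_compose_uminus')
    show "fps_nth (8 * ?C ^ 2) 0 \<noteq> 0" by simp
    show "fps_nth E 0 = 0" using b by (simp add: E_def power2_eq_square)
    show H0: "fps_nth H 0 = 0" by (simp add: H_def G8_def)
    have "fps_nth (H * ?e 4 ^ 2) 1 = fps_nth (8 * fps_X * ?e 8 ^ 4) 1"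
      by (simp only: H)
    then have H1: "fps_nth H 1 = 8"
      using H0 by (simp add: fps_mult_nth_1 mult.assoc fps_mult_numeral_left fps_power_zeroth)
    then show "fps_nth H 1 \<noteq> 0" by simp
    have "fps_nth E 1 = 8"
      using b by (simp add: E_def power2_eq_square fps_mult_nth_1)
    with H1 show "fps_nth E 1 = fps_nth H 1" by simp
  qed
  then show ?thesis by (simp add: E_def H_def)
qed

text \<open>
  Eliminating \<open>\<Prod>(1 - (-q)\<^sup>n)\<close>, whose square is \<open>\<theta>(q) \<Prod>(1 - q\<^bsup>2n\<^esup>)\<close>, gives
  \<open>G\<^sub>2(-q) \<theta>(q)\<^bsup>12\<^esup>\<close> as \<open>- q\<close> times a power of Euler's product in \<open>q\<^sup>2\<close>.  On the other side
  \<open>\<theta>(q)\<^sup>4 - \<theta>(-q)\<^sup>4\<close> is an eta quotient too, because both factors \<open>\<theta>(q)\<^sup>2 \<plusminus> \<theta>(-q)\<^sup>2\<close> are.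
\<close>

lemma G2_theta:
  "16 * (G2 oo - fps_X) * theta3 ^ 8
   = - ((theta3 oo - fps_X) ^ 4 * (theta3 ^ 4 - (theta3 oo - fps_X) ^ 4))"
proof -
  let ?a = theta3 and ?b = "theta3 oo - fps_X" and ?A = "theta3 oo fps_X ^ 2"
    and ?B = "theta3 oo - (fps_X ^ 2)"
  let ?e = "\<lambda>k. euler oo fps_X ^ k"
  let ?G = "G2 oo - fps_X"
  have e2: "(f oo fps_X ^ 2) oo - fps_X = f oo fps_X ^ 2" for f :: "complex fps"
    by (rule compose_X_even_power_uminus) simp_all
  have sq: "(euler oo - fps_X) ^ 2 = ?a * ?e 2"
  proof -
    have "euler ^ 2 oo - fps_X = (?b * ?e 2) oo - fps_X" by (simp only: euler_square)
    then show ?thesis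
      by (simp add: fps_compose_mult_distrib fps_compose_power e2 compose_uminus_X_twice)
  qed
  have "(G2 * euler ^ 24) oo - fps_X = (fps_X * ?e 2 ^ 24) oo - fps_X"
    by (simp only: G2_euler)
  then have "?G * ((euler oo - fps_X) ^ 2) ^ 12 = - (fps_X * ?e 2 ^ 24)"
    by (simp add: fps_compose_mult_distrib fps_compose_power e2 flip: power_mult)
  then have "(?G * ?a ^ 12) * ?e 2 ^ 12 = (- (fps_X * ?e 2 ^ 12)) * ?e 2 ^ 12"
    unfolding sq by (simp add: power_mult_distrib mult_ac flip: power_add)
  then have G: "?G * ?a ^ 12 = - (fps_X * ?e 2 ^ 12)"
    by (simp only: mult_cancel_right) simp
  have D: "(?a ^ 4 - ?b ^ 4) * ?e 2 ^ 4 = 16 * fps_X * ?e 4 ^ 8"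
  proof -
    have A: "?A * (?e 2 ^ 2 * ?e 8 ^ 2) = ?e 4 ^ 5"
    proof -
      have "(theta3 * (euler ^ 2 * ?e 4 ^ 2)) oo fps_X ^ 2 = (?e 2 ^ 5) oo fps_X ^ 2"
        by (simp only: theta3_euler)
      then show ?thesis
        by (simp add: fps_compose_mult_distrib fps_compose_power compose_X_power_twice)
    qed
    have H: "(?a ^ 2 - ?b ^ 2) * ?e 4 ^ 2 = 8 * fps_X * ?e 8 ^ 4"
      unfolding G8_theta[symmetric] using G8_theta4 by (simp add: mult_ac)
    have "?a ^ 4 - ?b ^ 4 = (?a ^ 2 - ?b ^ 2) * (?a ^ 2 + ?b ^ 2)"
      by (simp add: eval_nat_numeral algebra_simps)
    then have "((?a ^ 4 - ?b ^ 4) * ?e 2 ^ 4) * (?e 4 ^ 2 * ?e 8 ^ 4)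
        = 2 * ((?a ^ 2 - ?b ^ 2) * ?e 4 ^ 2) * (?A * (?e 2 ^ 2 * ?e 8 ^ 2)) ^ 2"
      by (simp add: theta_square_sum power_mult_distrib mult_ac flip: power_mult)
    also have "\<dots> = (16 * fps_X * ?e 4 ^ 8) * (?e 4 ^ 2 * ?e 8 ^ 4)"
      unfolding H A by (simp add: mult_ac flip: power_mult power_add)
    finally show ?thesis by simp
  qed
  have "(16 * ?G * ?a ^ 8) * (?a ^ 4 * ?e 2 ^ 4) = 16 * (?G * ?a ^ 12) * ?e 2 ^ 4"
    by (simp add: mult_ac flip: power_add)
  also have "\<dots> = - (16 * fps_X * (?e 2 ^ 2) ^ 8)"
    unfolding G by (simp add: mult_ac flip: power_add power_mult)
  also have "\<dots> = - (?B ^ 8 * (16 * fps_X * ?e 4 ^ 8))"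
    using euler_square_compose[of 2] by (simp add: power_mult_distrib mult_ac)
  also have "\<dots> = - ((?a * ?b) ^ 4 * ((?a ^ 4 - ?b ^ 4) * ?e 2 ^ 4))"
    unfolding D theta_product by (simp flip: power_mult)
  also have "\<dots> = - (?b ^ 4 * (?a ^ 4 - ?b ^ 4)) * (?a ^ 4 * ?e 2 ^ 4)"
    by (simp add: power_mult_distrib mult_ac)
  finally have "(16 * ?G * ?a ^ 8) * (?a ^ 4 * ?e 2 ^ 4) = - (?b ^ 4 * (?a ^ 4 - ?b ^ 4)) * (?a ^ 4 * ?e 2 ^ 4)" .
  moreover have "?a ^ 4 * ?e 2 ^ 4 \<noteq> 0"
  proof -
    have "theta3 \<noteq> 0" using theta_nth(1) by force
    then show ?thesis by simp
  qed
  ultimately show ?thesis by (simp only: mult_cancel_right) simp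
qed

section \<open>The Atkin operator\<close>

text \<open>
  Adding \<open>F(-q)\<close> to \<open>F(q)\<close> doubles the even part of \<open>F\<close>, and that even part is \<open>U\<^sub>2 F\<close> at \<open>q\<^sup>2\<close>.
\<close>

lemma U2_eqI:
  fixes F G :: "complex fps"
  assumes "F + (F oo - fps_X) = 2 * (G oo fps_X ^ 2)"
  shows "U2 F = G"
proof (rule fps_ext)
  fix n
  have "fps_nth (F + (F oo - fps_X)) (2 * n) = fps_nth (2 * (G oo fps_X ^ 2)) (2 * n)"
    by (simp only: assms)
  then show "fps_nth (U2 F) n = fps_nth G n"
    by (simp add: U2_def fps_compose_uminus' fps_nth_compose_X_power fps_mult_numeral_left)
qed

text \<open>
  The origin of the polynomial \<open>P\<close>.  Put \<open>g = (a - b)\<^sup>2 / (16 a b)\<close>, the value of \<open>G\<^sub>8(q\<^sup>2)\<close>.  Averaging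
  \<open>\<Phi>\<^sub>2(-q) G\<^sub>2(-q)\<close> over \<open>q \<rightarrow> - q\<close> gives \<open>(a\<^sup>4 - b\<^sup>4) (a\<^bsup>13\<^esup> - b\<^bsup>13\<^esup>) / (32 (a b)\<^sup>9)\<close>, and \<open>P(g)\<close> is this
  divided by \<open>\<Phi>\<^sub>2(-q\<^sup>4) = 2 / (a + b)\<close>.
\<close>

lemma P_poly_symmetric_form:
  fixes a b g :: "'a :: idom"
  assumes "16 * g * (a * b) = (a - b) ^ 2"
  shows "(16 * (a * b)) ^ 9 * (64 * poly P_poly g)
    = 16 ^ 9 * ((a + b) * (a ^ 4 - b ^ 4) * (a ^ 13 - b ^ 13))"
proof -
  define m where "m = 16 * (a * b)"
  define w where "w = (a - b) ^ 2"
  have mg: "m * g = w" using assms by (simp add: m_def w_def mult_ac)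
  \<comment> \<open>homogenisation: nine factors \<open>m\<close> clear the denominators of \<open>P (w / m)\<close>\<close>
  have hom: "m ^ 9 * (c * g ^ i) = c * w ^ i * m ^ (9 - i)" if "i \<le> 9" for c i
  proof -
    have "m ^ 9 = m ^ i * m ^ (9 - i)" using that by (simp flip: power_add)
    then show ?thesis by (simp add: mg[symmetric] power_mult_distrib mult_ac)
  qed
  have "m ^ 9 * poly P_poly g
     = m ^ 9 * (26 * g ^ 1) + m ^ 9 * (3224 * g ^ 2) + m ^ 9 * (128960 * g ^ 3) + m ^ 9 * (2489344 * g ^ 4)
     + m ^ 9 * (26836992 * g ^ 5) + m ^ 9 * (170393600 * g ^ 6) + m ^ 9 * (633339904 * g ^ 7)
     + m ^ 9 * (1275068416 * g ^ 8) + m ^ 9 * (1073741824 * g ^ 9)"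
    by (simp add: P_poly_def eval_nat_numeral ring_distribs mult_ac)
  also have "\<dots> = 26 * w ^ 1 * m ^ 8 + 3224 * w ^ 2 * m ^ 7 + 128960 * w ^ 3 * m ^ 6 + 2489344 * w ^ 4 * m ^ 5
     + 26836992 * w ^ 5 * m ^ 4 + 170393600 * w ^ 6 * m ^ 3 + 633339904 * w ^ 7 * m ^ 2
     + 1275068416 * w ^ 8 * m ^ 1 + 1073741824 * w ^ 9"
    by (simp only: hom) simp
  finally show ?thesis
    unfolding m_def[symmetric] unfolding m_def w_def by algebra
qed

text \<open>
  The four claims at \<open>q\<^sup>2\<close>, as algebra.  The intended values are \<open>a = \<theta>(q)\<close>, \<open>b = \<theta>(-q)\<close>, \<open>C = \<theta>(q\<^sup>4)\<close>, \<open>g = G\<^sub>8(q\<^sup>2)\<close>,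
  \<open>R = \<Phi>\<^sub>2(-q\<^sup>4)\<close>; the pairs \<open>(T, T')\<close>, \<open>(G, G')\<close>, \<open>(K, K')\<close> are \<open>\<Phi>\<^sub>2(-q)\<close>, \<open>G\<^sub>8(q)\<close>, \<open>G\<^sub>2(-q)\<close>, each with its image
  under \<open>q \<rightarrow> - q\<close>.  Clearing denominators reduces each claim to a symmetric polynomial in \<open>a\<close> and \<open>b\<close>, in which
  \<open>a + b = 2 C\<close> and \<open>(a - b)\<^sup>2 = 16 a b g\<close> can be substituted.
\<close>

lemma U2_identities_algebra:
  fixes a b C T T' R g G G' K K' P :: "'a :: {idom, semiring_char_0}"
  assumes nz: "a \<noteq> 0" "b \<noteq> 0" "C \<noteq> 0"
    and T: "T * a = 1" "T' * b = 1" "R * C = 1"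
    and C: "a + b = 2 * C"
    and g: "16 * g * (a * b) = (a - b) ^ 2"
    and G: "8 * G * b ^ 2 = a ^ 2 - b ^ 2" "8 * G' * a ^ 2 = b ^ 2 - a ^ 2"
    and K: "16 * K * a ^ 8 = - (b ^ 4 * (a ^ 4 - b ^ 4))" "16 * K' * b ^ 8 = - (a ^ 4 * (b ^ 4 - a ^ 4))"
  shows "G + G' = 2 * (4 * g + 16 * g ^ 2)"
    and "T + T' = 2 * ((1 + 4 * g) * R)"
    and "T * G + T' * G' = 2 * ((2 * g + 8 * g ^ 2) * R)"
    and "T * K + T' * K' = 2 * (poly P_poly g * R)"
proof -
  have G_sum: "8 * (a ^ 2 * b ^ 2) * (G + G') = (a ^ 2 - b ^ 2) ^ 2"
    using G by algebra
  have quad: "16 * (a ^ 2 * b ^ 2) * (g + 4 * g ^ 2) = (a - b) ^ 2 * C ^ 2"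
  proof -
    have "64 * (a ^ 2 * b ^ 2) * (g + 4 * g ^ 2) = (a - b) ^ 2 * (a + b) ^ 2"
      using g by algebra
    then have "4 * (16 * (a ^ 2 * b ^ 2) * (g + 4 * g ^ 2)) = 4 * ((a - b) ^ 2 * C ^ 2)"
      using C by algebra
    then show ?thesis by (simp only: mult_cancel_left) simp
  qed
  show "G + G' = 2 * (4 * g + 16 * g ^ 2)"
  proof -
    have "(a ^ 2 - b ^ 2) ^ 2 = (a - b) ^ 2 * (a + b) ^ 2" by algebra
    also have "\<dots> = 4 * ((a - b) ^ 2 * C ^ 2)"
      unfolding C by (simp add: power_mult_distrib)
    finally have "8 * (a ^ 2 * b ^ 2) * (G + G') = 8 * (a ^ 2 * b ^ 2) * (2 * (4 * g + 16 * g ^ 2))"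
      unfolding G_sum quad[symmetric] by (simp add: algebra_simps)
    then show ?thesis using nz by simp
  qed
  show "T + T' = 2 * ((1 + 4 * g) * R)"
  proof -
    have "a * b * (T + T') = 2 * C" using T C by algebra
    moreover have "a * b * (1 + 4 * g) = C ^ 2"
    proof -
      have "4 * (a * b * (1 + 4 * g)) = (a + b) ^ 2" using g by algebra
      also have "\<dots> = 4 * C ^ 2" unfolding C by (simp add: power_mult_distrib)
      finally show ?thesis by (simp only: mult_cancel_left) simp
    qed
    ultimately have "a * b * (T + T') = a * b * (2 * ((1 + 4 * g) * R))"
      using T(3) by algebra
    then show ?thesis using nz by simp
  qed
  show "T * G + T' * G' = 2 * ((2 * g + 8 * g ^ 2) * R)"
  proof -
    have "8 * (a ^ 2 * b ^ 2) * (T * G + T' * G') * (a * b) = (a - b) ^ 2 * (a + b) * (a * b)"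
    proof -
      have "8 * (a ^ 2 * b ^ 2) * (T * G + T' * G') * (a * b)
          = a ^ 2 * b * (T * a) * (8 * G * b ^ 2) + a * b ^ 2 * (T' * b) * (8 * G' * a ^ 2)"
        by algebra
      also have "\<dots> = (a - b) ^ 2 * (a + b) * (a * b)"
        unfolding G T by algebra
      finally show ?thesis .
    qed
    then have 1: "8 * (a ^ 2 * b ^ 2) * (T * G + T' * G') = (a - b) ^ 2 * (2 * C)"
      using nz unfolding C by simp
    have "8 * (a ^ 2 * b ^ 2) * (2 * ((2 * g + 8 * g ^ 2) * R)) = 2 * (16 * (a ^ 2 * b ^ 2) * (g + 4 * g ^ 2)) * R"
      by algebra
    also have "\<dots> = (a - b) ^ 2 * (2 * C) * (R * C)" unfolding quad by algebra
    finally have "8 * (a ^ 2 * b ^ 2) * (T * G + T' * G') = 8 * (a ^ 2 * b ^ 2) * (2 * ((2 * g + 8 * g ^ 2) * R))"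
      unfolding 1 T by simp
    then show ?thesis
      by (rule mult_left_cancel[THEN iffD1, rotated]) (use nz in simp)
  qed
  show "T * K + T' * K' = 2 * (poly P_poly g * R)"
  proof -
    have "16 * (a * b) ^ 9 * (T * K + T' * K')
        = b ^ 9 * (T * a) * (16 * K * a ^ 8) + a ^ 9 * (T' * b) * (16 * K' * b ^ 8)"
      by algebra
    also have "\<dots> = (a ^ 4 - b ^ 4) * (a ^ 13 - b ^ 13)"
      unfolding K T by algebra
    finally have 1: "16 * (a * b) ^ 9 * (T * K + T' * K') = (a ^ 4 - b ^ 4) * (a ^ 13 - b ^ 13)" .
    have "(16 * (a * b)) ^ 9 * (64 * poly P_poly g)
        = 16 ^ 9 * ((2 * C) * (16 * (a * b) ^ 9 * (T * K + T' * K')))"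
      unfolding P_poly_symmetric_form[OF g] 1 C by (simp only: mult.assoc)
    moreover have "16 ^ 9 * 32 * (a * b) ^ 9 * (2 * poly P_poly g) = (16 * (a * b)) ^ 9 * (64 * poly P_poly g)"
      by algebra
    moreover have "16 ^ 9 * ((2 * C) * (16 * (a * b) ^ 9 * (T * K + T' * K')))
        = 16 ^ 9 * 32 * (a * b) ^ 9 * (C * (T * K + T' * K'))"
      by algebra
    ultimately have "16 ^ 9 * 32 * (a * b) ^ 9 * (2 * poly P_poly g)
        = 16 ^ 9 * 32 * (a * b) ^ 9 * (C * (T * K + T' * K'))"
      by (simp only:)
    then have "2 * poly P_poly g = C * (T * K + T' * K')"
      by (rule mult_left_cancel[THEN iffD1, rotated]) (use nz in simp)
    then show ?thesis using T(3) by algebra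
  qed
qed

theorem lemma3p8:
  shows "U2 G8 = 4 * G8 + 16 * G8 ^ 2 \<and>
    U2 (Phi2 oo (- fps_X)) = (1 + 4 * G8) * (Phi2 oo (- (fps_X ^ 2))) \<and>
    U2 ((Phi2 oo (- fps_X)) * G8) = (2 * G8 + 8 * G8 ^ 2) * (Phi2 oo (- (fps_X ^ 2))) \<and>
    U2 ((Phi2 oo (- fps_X)) * (G2 oo (- fps_X))) = poly P_poly G8 * (Phi2 oo (- (fps_X ^ 2)))"
proof -
  define a where "a = theta3"
  define b where "b = theta3 oo - fps_X"
  define C where "C = theta3 oo fps_X ^ 4"
  define T where "T = Phi2 oo - fps_X"
  define R where "R = Phi2 oo - (fps_X ^ 4)"
  define g where "g = G8 oo fps_X ^ 2"
  define G' where "G' = G8 oo - fps_X"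
  define K where "K = G2 oo - fps_X"
  have b_neg: "b oo - fps_X = a" and T_neg: "T oo - fps_X = Phi2" and K_neg: "K oo - fps_X = G2"
    by (simp_all add: a_def b_def T_def K_def compose_uminus_X_twice)
  have "fps_nth a 0 = 1" "fps_nth b 0 = 1" "fps_nth C 0 = 1"
    by (simp_all add: a_def b_def C_def)
  then have nz: "a \<noteq> 0" "b \<noteq> 0" "C \<noteq> 0"
    by (metis fps_zero_nth zero_neq_one)+
  have T': "Phi2 * b = 1" using Phi2_theta by (simp add: b_def)
  have T: "T * a = 1"
  proof -
    have "(Phi2 * b) oo - fps_X = 1 oo - fps_X" by (simp only: T')
    then show ?thesis by (simp add: fps_compose_mult_distrib T_def b_neg)
  qed
  have R: "R * C = 1"
  proof -
    have "(T * a) oo fps_X ^ 4 = 1 oo fps_X ^ 4" by (simp only: T)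
    then show ?thesis
      by (simp add: fps_compose_mult_distrib T_def R_def a_def C_def compose_uminus_X_power)
  qed
  have G: "8 * G8 * b ^ 2 = a ^ 2 - b ^ 2" using G8_theta by (simp add: a_def b_def)
  have G': "8 * G' * a ^ 2 = b ^ 2 - a ^ 2"
  proof -
    have "(8 * G8 * b ^ 2) oo - fps_X = (a ^ 2 - b ^ 2) oo - fps_X" by (simp only: G)
    then show ?thesis
      by (simp add: fps_compose_mult_distrib fps_compose_sub_distrib b_neg power2_eq_square G'_def)
         (simp add: a_def b_def)
  qed
  have g: "16 * g * (a * b) = (a - b) ^ 2"
  proof -
    have "(8 * G8 * b ^ 2) oo fps_X ^ 2 = (a ^ 2 - b ^ 2) oo fps_X ^ 2" by (simp only: G)
    then have "8 * g * (theta3 oo - (fps_X ^ 2)) ^ 2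
        = (theta3 oo fps_X ^ 2) ^ 2 - (theta3 oo - (fps_X ^ 2)) ^ 2"
      by (simp add: fps_compose_mult_distrib fps_compose_sub_distrib fps_compose_power[symmetric]
          g_def a_def b_def compose_uminus_X_power)
    then have "2 * (8 * g * (a * b)) = a ^ 2 + b ^ 2 - 2 * (a * b)"
      unfolding a_def b_def theta_product theta_square_sum by simp
    then show ?thesis by (simp add: power2_eq_square algebra_simps)
  qed
  have K: "16 * K * a ^ 8 = - (b ^ 4 * (a ^ 4 - b ^ 4))"
    using G2_theta by (simp add: a_def b_def K_def)
  have K': "16 * G2 * b ^ 8 = - (a ^ 4 * (b ^ 4 - a ^ 4))"
  proof -
    have ab: "a oo - fps_X = b" by (simp add: a_def b_def)
    have "(16 * K * a ^ 8) oo - fps_X = (- (b ^ 4 * (a ^ 4 - b ^ 4))) oo - fps_X" by (simp only: K)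
    then show ?thesis
      by (simp add: fps_compose_mult_distrib fps_compose_sub_distrib fps_compose_uminus
          fps_compose_power[symmetric] b_neg K_neg ab)
  qed
  have C: "a + b = 2 * C" using theta_sum by (simp add: a_def b_def C_def)
  note ids = U2_identities_algebra[OF nz T T' R C g G G' K K']
  have Phi_R: "(Phi2 oo - (fps_X ^ 2)) oo fps_X ^ 2 = R"
    by (simp add: R_def fps_compose_assoc[symmetric] fps_compose_uminus fps_X_power_compose flip: power_mult)
  have P_comp: "poly P_poly G8 oo fps_X ^ 2 = poly P_poly g"
    by (simp add: P_poly_def fps_compose_mult_distrib fps_compose_add_distrib g_def)
  show ?thesis
  proof (intro conjI; rule U2_eqI)
    show "G8 + (G8 oo - fps_X) = 2 * ((4 * G8 + 16 * G8 ^ 2) oo fps_X ^ 2)"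
      using ids(1) by (simp add: fps_compose_add_distrib fps_compose_mult_distrib power2_eq_square G'_def g_def)
    show "(Phi2 oo - fps_X) + (Phi2 oo - fps_X oo - fps_X)
        = 2 * ((1 + 4 * G8) * (Phi2 oo - (fps_X ^ 2)) oo fps_X ^ 2)"
      using ids(2) by (simp add: fps_compose_add_distrib fps_compose_mult_distrib Phi_R T_neg
          flip: T_def g_def)
    show "(Phi2 oo - fps_X) * G8 + ((Phi2 oo - fps_X) * G8 oo - fps_X)
        = 2 * ((2 * G8 + 8 * G8 ^ 2) * (Phi2 oo - (fps_X ^ 2)) oo fps_X ^ 2)"
      using ids(3) by (simp add: fps_compose_add_distrib fps_compose_mult_distrib fps_compose_power[symmetric] Phi_R T_neg
          flip: T_def g_def G'_def)
    show "(Phi2 oo - fps_X) * (G2 oo - fps_X) + ((Phi2 oo - fps_X) * (G2 oo - fps_X) oo - fps_X)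
        = 2 * (poly P_poly G8 * (Phi2 oo - (fps_X ^ 2)) oo fps_X ^ 2)"
      using ids(4) by (simp add: fps_compose_mult_distrib Phi_R T_neg K_neg P_comp
          flip: T_def K_def)
  qed
qed

end
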